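(* If a strict intensity profile with $n$ agents and $n$ items can be partitioned into homeo-monotonic sets and an envy-free set (the latter possibly empty), then it has an intensity-efficient allocation.
   Context: Let $A$ be a set of $n$ items and $N=\{1,\dots,n\}$ a set of $n$ agents. The intensity relation of agent $l$ is a binary relation $\dot{\succsim}_l$ on $A\times A$ with symmetric part $\dot{\sim}_l$; its induced preference on $A$ is $a\succsim_l b \Leftrightarrow (a,b)\,\dot{\succsim}_l\,(b,a)$, with asymmetric part $\succ_l$. $\dot{\succsim}_l$ is representable by a preference intensity function if there is $s_l:A\times A\to\mathbb{R}$ such that for all $a,b,c,d,e\in A$: (i) $(a,b)\,\dot{\succsim}_l\,(c,d)\Leftrightarrow s_l(a,b)\ge s_l(c,d)$; (ii) $(a,b)\,\dot{\succsim}_l\,(b,a)\Leftrightarrow s_l(a,b)\ge s_l(e,e)\ge s_l(b,a)$; (iii) $\min\{s_l(a,b),s_l(b,c)\}\ge s_l(e,e)$ implies $s_l(a,c)\ge\max\{s_l(a,b),s_l(b,c)\}$, and a strict inequality in the hypothesis implies a strict inequality in the conclusion; (iv) (reversal) $s_l(a,b)\ge s_l(c,d)\Leftrightarrow s_l(d,c)\ge s_l(b,a)$. Strictness: $(a,b)\,\dot{\sim}_l\,(c,d)$ fails for all distinct pairs $(a,b)\neq(c,d)$ with $a\ne b$, $c\ne d$. A strict intensity profile is a tuple $(\dot{\succsim}_1,\dots,\dot{\succsim}_n)$ of representable relations satisfying Strictness; each induced preference is then a strict linear order. From now on $s_l$ denotes the canonical representation of $\dot{\succsim}_l$, i.e.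 the one with range $\{-k,\dots,-1,0,1,\dots,k\}$, $k=\binom n2$; it satisfies $s_l(a,a)=0$, $s_l(a,b)=-s_l(b,a)$ and $s_l(a,b)>0\Leftrightarrow a\succ_l b$. An allocation is a bijection $x:N\to A$, $i\mapsto x_i$. It is Pareto-efficient if no allocation $y$ satisfies $y_i\succsim_i x_i$ for all $i$ and $y_i\succ_i x_i$ for some $i$. Allocation $x$ intensity-dominates allocation $y$ if for every pair of distinct agents $(i,j)$ such that $(x_i,x_j)=(y_j,y_i)=(a,b)$ it holds that $s_i(a,b)\ge s_j(a,b)$, with strict inequality for some such pair. An allocation is intensity-efficient if it is Pareto-efficient and not intensity-dominated by another Pareto-efficient allocation. For $N'\subseteq N$, $A'\subseteq A$, the pair $\{N',A'\}$ is: - envy-free if $|N'|=|A'|$, the agents in $N'$ have pairwise distinct most preferred items in $A$, and these items lie in $A'$; - top-preference-coincident if all agents in $N'$ have the same preference restricted to $A'$ and, whenever $A'\subsetneq A$, $a'\succ_i a$ for all $a'\in A'$, $a\in A\setminus A'$, $i\in N'$; - monotonic if it is top-preference-coincident, $|N'|=|A'|=:r$ and, writing the common preference as $c_1\succ c_2\succ\cdots\succ c_r$ on $A'=\{c_1,\dots,c_r\}$, there is an enumeration $\pi(1),\dots,\pi(r)$ of the agents in $N'$ such that $s_{\pi(p)}(c_1,c_2)>s_{\pi(p)}(c_2,c_3)>\cdots>s_{\pi(p)}(c_{r-1},c_r)>0$ for each $p\le r$, and $s_{\pi(p)}(c_q,c_{q+1})\ge s_{\pi(p+1)}(c_q,c_{q+1})$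 for all $p,q\le r-1$; - homeo-monotonic if it is monotonic (with enumeration $\pi$) and $s_{\pi(i)}(c_i,c_j)\ge s_{\pi(j)}(c_i,c_j)$ for all $i<j\le r$. A profile can be partitioned into homeo-monotonic sets and an envy-free set (possibly empty) if there are pairs $\{N^i,A^i\}$, $i\le m$, such that $(N^i)_{i\le m}$ partitions $N$, $(A^i)_{i\le m}$ partitions $A$, and each $\{N^i,A^i\}$ is homeo-monotonic or envy-free (with at most one cell being designated as the envy-free one). *)

theory Defs
  imports Complex_Main "HOL-Library.Disjoint_Sets"
begin

(* Intensity relations and allocations live on whole types; only their values on the
   item set A and on the agent set {1..n} are ever used. *)

type_synonym 'a intensity_rel = "'a \<times> 'a \<Rightarrow> 'a \<times> 'a \<Rightarrow> bool"

definition weak_pref :: "'a intensity_rel \<Rightarrow> 'a \<Rightarrow> 'a \<Rightarrow> bool" where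
  "weak_pref Q a b \<longleftrightarrow> Q (a, b) (b, a)"

definition strict_pref :: "'a intensity_rel \<Rightarrow> 'a \<Rightarrow> 'a \<Rightarrow> bool" where
  "strict_pref Q a b \<longleftrightarrow> weak_pref Q a b \<and> \<not> weak_pref Q b a"

(* The four conjuncts are: order representation, sign, lateral consistency, reversal.
   In the third, the strict hypothesis is that the minimum is strict; with a single strict
   inequality the condition would fail already for a = b. *)
definition represents :: "'a set \<Rightarrow> 'a intensity_rel \<Rightarrow> ('a \<Rightarrow> 'a \<Rightarrow> real) \<Rightarrow> bool" where
  "represents A Q s \<longleftrightarrow>
     (\<forall>a\<in>A. \<forall>b\<in>A. \<forall>c\<in>A. \<forall>d\<in>A. Q (a, b) (c, d) \<longleftrightarrow> s a b \<ge> s c d) \<and>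
     (\<forall>a\<in>A. \<forall>b\<in>A. \<forall>e\<in>A. Q (a, b) (b, a) \<longleftrightarrow> s a b \<ge> s e e \<and> s e e \<ge> s b a) \<and>
     (\<forall>a\<in>A. \<forall>b\<in>A. \<forall>c\<in>A. \<forall>e\<in>A.
        (min (s a b) (s b c) \<ge> s e e \<longrightarrow> s a c \<ge> max (s a b) (s b c)) \<and>
        (min (s a b) (s b c) > s e e \<longrightarrow> s a c > max (s a b) (s b c))) \<and>
     (\<forall>a\<in>A. \<forall>b\<in>A. \<forall>c\<in>A. \<forall>d\<in>A. s a b \<ge> s c d \<longleftrightarrow> s d c \<ge> s b a)"

definition representable :: "'a set \<Rightarrow> 'a intensity_rel \<Rightarrow> bool" where
  "representable A Q \<longleftrightarrow> (\<exists>s. represents A Q s)"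

definition strict_intensity :: "'a set \<Rightarrow> 'a intensity_rel \<Rightarrow> bool" where
  "strict_intensity A Q \<longleftrightarrow>
     (\<forall>a\<in>A. \<forall>b\<in>A. \<forall>c\<in>A. \<forall>d\<in>A.
        a \<noteq> b \<longrightarrow> c \<noteq> d \<longrightarrow> (a, b) \<noteq> (c, d) \<longrightarrow> \<not> (Q (a, b) (c, d) \<and> Q (c, d) (a, b)))"

definition strict_intensity_profile :: "nat \<Rightarrow> 'a set \<Rightarrow> (nat \<Rightarrow> 'a intensity_rel) \<Rightarrow> bool" where
  "strict_intensity_profile n A R \<longleftrightarrow>
     (\<forall>l\<in>{1..n}. representable A (R l) \<and> strict_intensity A (R l))"

definition is_canonical :: "'a set \<Rightarrow> 'a intensity_rel \<Rightarrow> ('a \<Rightarrow> 'a \<Rightarrow> real) \<Rightarrow> bool" where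
  "is_canonical A Q s \<longleftrightarrow>
     represents A Q s \<and>
     {s a b | a b. a \<in> A \<and> b \<in> A} = real_of_int ` {- int (card A choose 2)..int (card A choose 2)}"

(* For a representable strict relation on a finite nonempty A, such an s exists and is
   unique on A \<times> A, so the choice only concerns irrelevant values outside A. *)
definition canonical :: "'a set \<Rightarrow> 'a intensity_rel \<Rightarrow> 'a \<Rightarrow> 'a \<Rightarrow> real" where
  "canonical A Q = (SOME s. is_canonical A Q s)"

definition allocation :: "nat \<Rightarrow> 'a set \<Rightarrow> (nat \<Rightarrow> 'a) \<Rightarrow> bool" where
  "allocation n A x \<longleftrightarrow> bij_betw x {1..n} A"

definition pareto_efficient ::
  "nat \<Rightarrow> 'a set \<Rightarrow> (nat \<Rightarrow> 'a intensity_rel) \<Rightarrow> (nat \<Rightarrow> 'a) \<Rightarrow> bool" where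
  "pareto_efficient n A R x \<longleftrightarrow>
     allocation n A x \<and>
     \<not> (\<exists>y. allocation n A y \<and>
            (\<forall>i\<in>{1..n}. weak_pref (R i) (y i) (x i)) \<and>
            (\<exists>i\<in>{1..n}. strict_pref (R i) (y i) (x i)))"

definition intensity_dominates ::
  "nat \<Rightarrow> 'a set \<Rightarrow> (nat \<Rightarrow> 'a intensity_rel) \<Rightarrow> (nat \<Rightarrow> 'a) \<Rightarrow> (nat \<Rightarrow> 'a) \<Rightarrow> bool" where
  "intensity_dominates n A R x y \<longleftrightarrow>
     (\<forall>i\<in>{1..n}. \<forall>j\<in>{1..n}. i \<noteq> j \<and> (x i, x j) = (y j, y i) \<longrightarrow>
        canonical A (R i) (x i) (x j) \<ge> canonical A (R j) (x i) (x j)) \<and>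
     (\<exists>i\<in>{1..n}. \<exists>j\<in>{1..n}. i \<noteq> j \<and> (x i, x j) = (y j, y i) \<and>
        canonical A (R i) (x i) (x j) > canonical A (R j) (x i) (x j))"

definition intensity_efficient ::
  "nat \<Rightarrow> 'a set \<Rightarrow> (nat \<Rightarrow> 'a intensity_rel) \<Rightarrow> (nat \<Rightarrow> 'a) \<Rightarrow> bool" where
  "intensity_efficient n A R x \<longleftrightarrow>
     pareto_efficient n A R x \<and>
     \<not> (\<exists>y. pareto_efficient n A R y \<and> intensity_dominates n A R y x)"

definition most_preferred :: "'a set \<Rightarrow> 'a intensity_rel \<Rightarrow> 'a \<Rightarrow> bool" where
  "most_preferred A Q t \<longleftrightarrow> t \<in> A \<and> (\<forall>a\<in>A. weak_pref Q t a)"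

definition envy_free ::
  "'a set \<Rightarrow> (nat \<Rightarrow> 'a intensity_rel) \<Rightarrow> nat set \<Rightarrow> 'a set \<Rightarrow> bool" where
  "envy_free A R N' A' \<longleftrightarrow>
     card N' = card A' \<and>
     (\<exists>t. (\<forall>i\<in>N'. most_preferred A (R i) (t i) \<and> t i \<in> A') \<and> inj_on t N')"

definition top_preference_coincident ::
  "'a set \<Rightarrow> (nat \<Rightarrow> 'a intensity_rel) \<Rightarrow> nat set \<Rightarrow> 'a set \<Rightarrow> bool" where
  "top_preference_coincident A R N' A' \<longleftrightarrow>
     (\<forall>i\<in>N'. \<forall>j\<in>N'. \<forall>a\<in>A'. \<forall>b\<in>A'. weak_pref (R i) a b \<longleftrightarrow> weak_pref (R j) a b) \<and>
     (A' \<subset> A \<longrightarrow> (\<forall>a'\<in>A'. \<forall>a\<in>A - A'. \<forall>i\<in>N'. strict_pref (R i) a' a))"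

(* c lists A' in decreasing order of the common preference, \<pi> enumerates N'. *)
definition monotonic_with ::
  "'a set \<Rightarrow> (nat \<Rightarrow> 'a intensity_rel) \<Rightarrow> nat set \<Rightarrow> 'a set \<Rightarrow> (nat \<Rightarrow> 'a) \<Rightarrow> (nat \<Rightarrow> nat) \<Rightarrow> bool" where
  "monotonic_with A R N' A' c \<pi> \<longleftrightarrow>
     top_preference_coincident A R N' A' \<and>
     card N' = card A' \<and>
     (let r = card A' in
        bij_betw c {1..r} A' \<and>
        (\<forall>i\<in>N'. \<forall>p\<in>{1..r}. \<forall>q\<in>{1..r}. p < q \<longrightarrow> strict_pref (R i) (c p) (c q)) \<and>
        bij_betw \<pi> {1..r} N' \<and>
        (\<forall>p\<in>{1..r}.
           (\<forall>q. 1 \<le> q \<and> q + 2 \<le> r \<longrightarrow>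
              canonical A (R (\<pi> p)) (c q) (c (q + 1)) >
              canonical A (R (\<pi> p)) (c (q + 1)) (c (q + 2))) \<and>
           (2 \<le> r \<longrightarrow> canonical A (R (\<pi> p)) (c (r - 1)) (c r) > 0)) \<and>
        (\<forall>p\<in>{1..r - 1}. \<forall>q\<in>{1..r - 1}.
           canonical A (R (\<pi> p)) (c q) (c (q + 1)) \<ge>
           canonical A (R (\<pi> (p + 1))) (c q) (c (q + 1))))"

definition homeo_monotonic ::
  "'a set \<Rightarrow> (nat \<Rightarrow> 'a intensity_rel) \<Rightarrow> nat set \<Rightarrow> 'a set \<Rightarrow> bool" where
  "homeo_monotonic A R N' A' \<longleftrightarrow>
     (\<exists>c \<pi>. monotonic_with A R N' A' c \<pi> \<and>
        (\<forall>i\<in>{1..card A'}. \<forall>j\<in>{1..card A'}. i < j \<longrightarrow>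
           canonical A (R (\<pi> i)) (c i) (c j) \<ge> canonical A (R (\<pi> j)) (c i) (c j)))"

(* E collects the index of the cell designated as envy-free, if there is one.
   Empty cells are allowed; an empty cell satisfies both cell conditions vacuously. *)
definition homeo_monotonic_envy_free_partition ::
  "nat \<Rightarrow> 'a set \<Rightarrow> (nat \<Rightarrow> 'a intensity_rel) \<Rightarrow> bool" where
  "homeo_monotonic_envy_free_partition n A R \<longleftrightarrow>
     (\<exists>(m::nat) (Ns :: nat \<Rightarrow> nat set) (As :: nat \<Rightarrow> 'a set) E.
        disjoint_family_on Ns {1..m} \<and> (\<Union>i\<in>{1..m}. Ns i) = {1..n} \<and>
        disjoint_family_on As {1..m} \<and> (\<Union>i\<in>{1..m}. As i) = A \<and>
        E \<subseteq> {1..m} \<and> card E \<le> 1 \<and>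
        (\<forall>i\<in>{1..m}. if i \<in> E then envy_free A R (Ns i) (As i)
                    else homeo_monotonic A R (Ns i) (As i)))"

end

theory Submission imports Defs begin

text \<open>
  In a homeo-monotonic cell give the item \<open>c\<^sub>p\<close> to the agent \<open>\<pi>(p)\<close>; in the envy-free cell give
  every agent the favourite item. Every agent then strictly prefers the own item to all items
  outside the own cell, so a Pareto improvement stays inside the cells, and there it is trivial
  because the preferences agree (or everybody is already on top). For the same reason agents of
  different cells never gain by swapping, whereas for a swap within a homeo-monotonic cell the
  homeo-monotonicity inequality is exactly the failure of strict dominance. Hence the allocation is
  not dominated by any allocation at all.
\<close>

section \<open>The canonical representation\<close>

text \<open>Every clause of \<open>represents\<close> compares values of \<open>s\<close> with each
  other, so an order embedding of its range preserves all of them. This allows any representation to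
  be rescaled to the canonical range.\<close>

lemma represents_strict_mono_comp:
  fixes h :: "real \<Rightarrow> real"
  assumes "represents A Q s" and h: "strict_mono_on {s a b | a b. a \<in> A \<and> b \<in> A} h"
  shows "represents A Q (\<lambda>a b. h (s a b))"
proof -
  have le: "h (s a b) \<le> h (s c d) \<longleftrightarrow> s a b \<le> s c d"
    if "a \<in> A" "b \<in> A" "c \<in> A" "d \<in> A" for a b c d
    using that by (intro strict_mono_on_less_eq[OF h]) auto
  have less: "h (s a b) < h (s c d) \<longleftrightarrow> s a b < s c d"
    if "a \<in> A" "b \<in> A" "c \<in> A" "d \<in> A" for a b c d
    using that by (intro strict_mono_on_less[OF h]) auto
  \<comment> \<open>The bounds on \<open>min\<close> and \<open>max\<close> split into plain
    comparisons, so \<open>le\<close> and \<open>less\<close> cover lateral consistency too.\<close>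
  have "represents A Q (\<lambda>a b. h (s a b)) \<longleftrightarrow> represents A Q s"
    unfolding represents_def by (simp add: le less)
  then show ?thesis using assms(1) by simp
qed

lemma ex_strict_mono_on_centred_interval:
  fixes V :: "real set"
  assumes fin: "finite V" and card: "card V = 2 * k + 1"
  shows "\<exists>h. strict_mono_on V h \<and> h ` V = real_of_int ` {- int k..int k}"
proof -
  \<comment> \<open>The rank of \<open>v\<close> in \<open>V\<close>, counted from 0. By cardinality
    the ranks fill \<open>{..2 * k}\<close>; subtracting \<open>k\<close> later centres them at
    0.\<close>
  define r where "r v = card {w\<in>V. w < v}" for v
  have mono: "r v < r w" if "v \<in> V" "w \<in> V" "v < w" for v w
    unfolding r_def by (rule psubset_card_mono) (use that fin in auto)
  have "r v \<le> 2 * k" if "v \<in> V" for v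
  proof -
    have "r v < card V"
      unfolding r_def by (rule psubset_card_mono) (use that fin in auto)
    then show ?thesis using card by simp
  qed
  then have sub: "r ` V \<subseteq> {..2 * k}" by auto
  have "inj_on r V"
    by (rule linorder_inj_onI') (metis mono less_irrefl)
  then have "card (r ` V) = card {..2 * k}"
    using card by (simp add: card_image)
  then have rV: "r ` V = {..2 * k}"
    using sub by (simp add: card_subset_eq)
  define h where "h v = real_of_int (int (r v) - int k)" for v
  have "strict_mono_on V h"
    using mono by (auto simp: strict_mono_on_def h_def)
  moreover have "(\<lambda>m. int m - int k) ` {..2 * k} = {- int k..int k}"
  proof (intro equalityI subsetI)
    fix v assume "v \<in> {- int k..int k}"
    then show "v \<in> (\<lambda>m. int m - int k) ` {..2 * k}"
      by (intro image_eqI[where x = "nat (v + int k)"]) auto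
  qed auto
  moreover have "h ` V = real_of_int ` (\<lambda>m. int m - int k) ` r ` V"
    by (simp add: h_def image_image)
  ultimately show ?thesis unfolding rV by auto
qed

text \<open>\<open>Q (a, a) (a, a)\<close> holds because the order on values is reflexive; the sign
  clause for the pair \<open>(a, a)\<close> then squeezes every other diagonal value between
  \<open>s a a\<close> and itself.\<close>

lemma represents_diag_eq:
  assumes "represents A Q s" "a \<in> A" "b \<in> A"
  shows "s a a = s b b"
proof -
  have "\<forall>a\<in>A. \<forall>b\<in>A. \<forall>e\<in>A. Q (a, b) (b, a) \<longleftrightarrow> s a b \<ge> s e e \<and> s e e \<ge> s b a"
    and "\<forall>a\<in>A. \<forall>b\<in>A. \<forall>c\<in>A. \<forall>d\<in>A. Q (a, b) (c, d) \<longleftrightarrow> s a b \<ge> s c d"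
    using assms(1) unfolding represents_def by blast+
  then show ?thesis using assms(2,3) by (meson order_antisym order_refl)
qed

lemma represents_reversal:
  assumes "represents A Q s" "a \<in> A" "b \<in> A" "c \<in> A" "d \<in> A"
  shows "s c d \<le> s a b \<longleftrightarrow> s b a \<le> s d c"
  using assms unfolding represents_def by blast

lemma represents_iff:
  assumes "represents A Q s" "a \<in> A" "b \<in> A" "c \<in> A" "d \<in> A"
  shows "Q (a, b) (c, d) \<longleftrightarrow> s c d \<le> s a b"
  using assms unfolding represents_def by blast

lemma represents_offdiag_inj:
  assumes "represents A Q s" "strict_intensity A Q"
    and "a \<in> A" "b \<in> A" "c \<in> A" "d \<in> A" "a \<noteq> b" "c \<noteq> d" "s a b = s c d"
  shows "(a, b) = (c, d)"
proof (rule ccontr)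
  assume "(a, b) \<noteq> (c, d)"
  then have "\<not> (Q (a, b) (c, d) \<and> Q (c, d) (a, b))"
    using assms unfolding strict_intensity_def by blast
  then show False using assms by (simp add: represents_iff[OF assms(1)])
qed

text \<open>Reversal fixes the diagonal value: if \<open>s a b\<close> were equal to it, so would be
  \<open>s b a\<close>, and the tie between \<open>(a, b)\<close> and \<open>(b, a)\<close>
  contradicts strictness.\<close>

lemma represents_offdiag_neq_diag:
  assumes "represents A Q s" "strict_intensity A Q" "a \<in> A" "b \<in> A" "e \<in> A" "a \<noteq> b"
  shows "s a b \<noteq> s e e"
proof
  assume eq: "s a b = s e e"
  then have "s b a = s e e"
    using represents_reversal[OF assms(1), of a b e e] represents_reversal[OF assms(1), of e e a b]
      assms by auto
  then show False
    using represents_offdiag_inj[OF assms(1,2), of a b b a] eq assms by auto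
qed

text \<open>The diagonal contributes one common value; the ordered pairs of distinct items
  contribute pairwise different values, all different from it.\<close>

lemma card_represents_range:
  assumes "finite A" "A \<noteq> {}" "represents A Q s" "strict_intensity A Q"
  shows "card {s a b | a b. a \<in> A \<and> b \<in> A} = 2 * (card A choose 2) + 1"
proof -
  obtain e where e: "e \<in> A" using assms by auto
  define D where "D = Sigma A (\<lambda>a. A - {a})"
  have V: "{s a b | a b. a \<in> A \<and> b \<in> A} = insert (s e e) (case_prod s ` D)"
  proof (intro equalityI subsetI)
    fix v assume "v \<in> {s a b | a b. a \<in> A \<and> b \<in> A}"
    then obtain a b where ab: "v = s a b" "a \<in> A" "b \<in> A" by blast
    show "v \<in> insert (s e e) (case_prod s ` D)"
    proof (cases "a = b")
      case True
      then show ?thesis using represents_diag_eq[OF assms(3) ab(2) e] ab by simp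
    next
      case False
      then show ?thesis using ab by (force simp: D_def)
    qed
  qed (use e in \<open>auto simp: D_def\<close>)
  have fin: "finite D" using assms(1) by (simp add: D_def)
  have "inj_on (case_prod s) D"
  proof (rule inj_onI)
    fix p q assume "p \<in> D" "q \<in> D" "case_prod s p = case_prod s q"
    then show "p = q"
      using represents_offdiag_inj[OF assms(3,4), of "fst p" "snd p" "fst q" "snd q"]
      by (auto simp: D_def)
  qed
  then have "card (case_prod s ` D) = card D" by (rule card_image)
  also have "\<dots> = card A * (card A - 1)"
    using assms(1) by (simp add: D_def)
  \<comment> \<open>The division in \<open>choose_two\<close> is exact, since one of two consecutive
    numbers is even.\<close>
  also have "\<dots> = 2 * (card A choose 2)"
    unfolding choose_two by (rule dvd_mult_div_cancel[symmetric]) (cases "card A", auto)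
  finally have "card (case_prod s ` D) = 2 * (card A choose 2)" .
  moreover have "s e e \<notin> case_prod s ` D"
  proof
    assume "s e e \<in> case_prod s ` D"
    then obtain a b where "a \<in> A" "b \<in> A" "a \<noteq> b" "s a b = s e e"
      by (auto simp: D_def dest: sym)
    then show False using represents_offdiag_neq_diag[OF assms(3,4) _ _ e] by blast
  qed
  ultimately show ?thesis unfolding V using fin by simp
qed

text \<open>Justifies the choice in \<open>canonical\<close>: the range of any representation has as
  many values as the centred integer interval, so composing with the increasing bijection between
  them gives a witness.\<close>

lemma is_canonical_canonical:
  assumes "finite A" "A \<noteq> {}" "representable A Q" "strict_intensity A Q"
  shows "is_canonical A Q (canonical A Q)"
proof -
  obtain s where s: "represents A Q s" using assms(3) unfolding representable_def by blast
  let ?V = "{s a b | a b. a \<in> A \<and> b \<in> A}"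
  have card: "card ?V = 2 * (card A choose 2) + 1"
    by (rule card_represents_range) (use assms s in auto)
  then have "finite ?V" by (simp add: card_ge_0_finite)
  then obtain h where h: "strict_mono_on ?V h"
      "h ` ?V = real_of_int ` {- int (card A choose 2)..int (card A choose 2)}"
    using ex_strict_mono_on_centred_interval[OF _ card] by blast
  have "h ` ?V = {h (s a b) | a b. a \<in> A \<and> b \<in> A}" by blast
  then have "is_canonical A Q (\<lambda>a b. h (s a b))"
    unfolding is_canonical_def using represents_strict_mono_comp[OF s h(1)] h(2) by simp
  then show ?thesis unfolding canonical_def by (rule someI[of "is_canonical A Q"])
qed

text \<open>Pigeonhole from both sides: the integers in \<open>{v..k}\<close> are sent injectively
  into \<open>{-k..g v}\<close>, which forces \<open>g v \<ge> - v\<close>, and those in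
  \<open>{-k..v}\<close> into \<open>{g v..k}\<close>, which forces
  \<open>g v \<le> - v\<close>.\<close>

lemma strict_antimono_on_centred_interval:
  fixes g :: "int \<Rightarrow> int"
  assumes anti: "\<And>v w. \<lbrakk>v \<in> {-k..k}; w \<in> {-k..k}; v < w\<rbrakk> \<Longrightarrow> g w < g v"
    and range: "g ` {-k..k} \<subseteq> {-k..k}" and v: "v \<in> {-k..k}"
  shows "g v = - v"
proof -
  have inj: "inj_on g {-k..k}"
    by (rule linorder_inj_onI') (metis anti less_irrefl)
  have le: "g w \<le> g u" if "u \<in> {-k..k}" "w \<in> {-k..k}" "u \<le> w" for u w
    using anti[of u w] that by (cases "u = w") auto
  have bound: "- k \<le> g w" "g w \<le> k" if "w \<in> {-k..k}" for w
    using range that by (auto simp: image_subset_iff)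
  have "card {v..k} \<le> card {-k..g v}"
    using v bound le by (intro card_inj_on_le[OF inj_on_subset[OF inj]]) auto
  moreover have "card {-k..v} \<le> card {g v..k}"
    using v bound le by (intro card_inj_on_le[OF inj_on_subset[OF inj]]) auto
  ultimately show ?thesis using v bound[OF v] by auto
qed

text \<open>By reversal, swapping the two arguments induces a strictly decreasing self-map of the
  integers from \<open>-k\<close> to \<open>k\<close>, and negation is the only such map.\<close>

lemma is_canonical_antisym:
  assumes can: "is_canonical A Q s" and ab: "a \<in> A" "b \<in> A"
  shows "s b a = - s a b"
proof -
  define k where "k = int (card A choose 2)"
  have rep: "represents A Q s"
    and V: "{s a b | a b. a \<in> A \<and> b \<in> A} = real_of_int ` {-k..k}"
    using can by (auto simp: is_canonical_def k_def)
  have "\<exists>p. p \<in> A \<times> A \<and> case_prod s p = real_of_int v" if "v \<in> {-k..k}" for v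
  proof -
    have "real_of_int v \<in> {s a b | a b. a \<in> A \<and> b \<in> A}" unfolding V using that by blast
    then show ?thesis by force
  qed
  then obtain P where P: "\<And>v. v \<in> {-k..k} \<Longrightarrow> P v \<in> A \<times> A"
      "\<And>v. v \<in> {-k..k} \<Longrightarrow> case_prod s (P v) = real_of_int v"
    by metis
  \<comment> \<open>The induced self-map, computed on the chosen pair \<open>P v\<close> of value
    \<open>v\<close>. All values are integers, so the floor is only a conversion of type.\<close>
  define g where "g v = \<lfloor>s (snd (P v)) (fst (P v))\<rfloor>" for v
  have int_val: "\<exists>v\<in>{-k..k}. s c d = real_of_int v" if "c \<in> A" "d \<in> A" for c d
  proof -
    have "s c d \<in> real_of_int ` {-k..k}" unfolding V[symmetric] using that by blast
    then show ?thesis by blast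
  qed
  have g: "real_of_int (g v) = s (snd (P v)) (fst (P v))" "g v \<in> {-k..k}" if "v \<in> {-k..k}" for v
    using int_val[of "snd (P v)" "fst (P v)"] P(1)[OF that] by (auto simp: g_def)
  have Pv: "fst (P v) \<in> A" "snd (P v) \<in> A" "s (fst (P v)) (snd (P v)) = real_of_int v"
    if "v \<in> {-k..k}" for v
    using P[OF that] by (auto simp: case_prod_beta)
  have g_neg: "g v = - v" if "v \<in> {-k..k}" for v
  proof (rule strict_antimono_on_centred_interval[OF _ _ that])
    fix v w assume vw: "v \<in> {-k..k}" "w \<in> {-k..k}" "v < w"
    have "\<not> s (fst (P w)) (snd (P w)) \<le> s (fst (P v)) (snd (P v))"
      using vw Pv by simp
    then have "\<not> s (snd (P v)) (fst (P v)) \<le> s (snd (P w)) (fst (P w))"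
      using represents_reversal[OF rep] Pv vw by blast
    then show "g w < g v" using g(1)[OF vw(1)] g(1)[OF vw(2)] by linarith
  qed (use g in auto)
  obtain v where v: "v \<in> {-k..k}" "s a b = real_of_int v" using int_val ab by blast
  \<comment> \<open>The pair \<open>P v\<close> need not be \<open>(a, b)\<close>, but reversal,
    applied in both directions, shows that pairs of equal value still have equal value after
    swapping.\<close>
  have "s (fst (P v)) (snd (P v)) = s a b" using Pv v by simp
  then have "s (snd (P v)) (fst (P v)) = s b a"
    using represents_reversal[OF rep] Pv v(1) ab by (metis order_antisym order_refl)
  then show ?thesis using g(1)[OF v(1)] g_neg[OF v(1)] v(2) by simp
qed

lemma canonical_antisym:
  assumes "finite A" "representable A Q" "strict_intensity A Q" "a \<in> A" "b \<in> A"
  shows "canonical A Q b a = - canonical A Q a b"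
proof -
  have "A \<noteq> {}" using assms by auto
  then have "is_canonical A Q (canonical A Q)"
    by (rule is_canonical_canonical[OF assms(1) _ assms(2,3)])
  then show ?thesis using assms(4,5) by (rule is_canonical_antisym)
qed

lemma canonical_pos:
  assumes "finite A" "representable A Q" "strict_intensity A Q" "a \<in> A" "b \<in> A"
    and "strict_pref Q a b"
  shows "0 < canonical A Q a b"
proof -
  have "represents A Q (canonical A Q)"
    using is_canonical_canonical[OF assms(1) _ assms(2,3)] assms(4) unfolding is_canonical_def by auto
  then have "canonical A Q b a < canonical A Q a b"
    using assms(4-6) represents_iff[of A Q "canonical A Q"]
    unfolding strict_pref_def weak_pref_def by auto
  then show ?thesis using canonical_antisym[OF assms(1-5)] by simp
qed

lemma most_preferred_strict_pref:
  assumes "strict_intensity A Q" "most_preferred A Q t" "a \<in> A" "a \<noteq> t"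
  shows "strict_pref Q t a"
proof -
  have "t \<in> A" "Q (t, a) (a, t)"
    using assms(2,3) unfolding most_preferred_def weak_pref_def by auto
  moreover have "\<not> (Q (t, a) (a, t) \<and> Q (a, t) (t, a))"
    using assms(1,3,4) \<open>t \<in> A\<close> unfolding strict_intensity_def by fast
  ultimately show ?thesis unfolding strict_pref_def weak_pref_def by simp
qed

section \<open>Assignments within a cell\<close>

text \<open>The interface between cells and gluing. The third clause denies a strict gain to any
  swap inside the cell. The last is Pareto rigidity; there \<open>g\<close> may use all of
  \<open>A\<close>, so that it can be the restriction of any allocation to the cell.\<close>

definition cell_assignment ::
  "'a set \<Rightarrow> (nat \<Rightarrow> 'a intensity_rel) \<Rightarrow> nat set \<Rightarrow> 'a set \<Rightarrow> (nat \<Rightarrow> 'a) \<Rightarrow> bool" where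
  "cell_assignment A R N' A' f \<longleftrightarrow>
     bij_betw f N' A' \<and>
     (\<forall>i\<in>N'. \<forall>a\<in>A - A'. strict_pref (R i) (f i) a) \<and>
     (\<forall>i\<in>N'. \<forall>j\<in>N'. i \<noteq> j \<longrightarrow>
        canonical A (R i) (f j) (f i) \<le> canonical A (R j) (f j) (f i)) \<and>
     (\<forall>g. inj_on g N' \<longrightarrow> g ` N' \<subseteq> A \<longrightarrow> (\<forall>i\<in>N'. weak_pref (R i) (g i) (f i)) \<longrightarrow>
        (\<forall>i\<in>N'. g i = f i))"

text \<open>Nobody can weakly improve on a favourite item except by keeping it. In a swap, agent
  \<open>i\<close> values \<open>(t j, t i)\<close> negatively and agent \<open>j\<close> values it
  positively, so the required inequality holds by sign.\<close>

lemma envy_free_cell_assignment: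
  assumes "finite A" "A' \<subseteq> A" "envy_free A R N' A'"
    and rep: "\<And>i. i \<in> N' \<Longrightarrow> representable A (R i)"
    and str: "\<And>i. i \<in> N' \<Longrightarrow> strict_intensity A (R i)"
  shows "\<exists>f. cell_assignment A R N' A' f"
proof -
  obtain t where t: "\<And>i. i \<in> N' \<Longrightarrow> most_preferred A (R i) (t i)" "\<And>i. i \<in> N' \<Longrightarrow> t i \<in> A'"
      "inj_on t N'" and card: "card N' = card A'"
    using assms(3) unfolding envy_free_def by blast
  have "finite A'" using assms finite_subset by blast
  then have "t ` N' = A'"
    using t card by (intro card_subset_eq) (auto simp: card_image)
  then have bij: "bij_betw t N' A'" using t by (simp add: bij_betw_def)
  have top: "strict_pref (R i) (t i) a" if "i \<in> N'" "a \<in> A" "a \<noteq> t i" for i a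
    using most_preferred_strict_pref[OF str t(1)] that by blast
  have swap: "canonical A (R i) (t j) (t i) \<le> canonical A (R j) (t j) (t i)"
    if ij: "i \<in> N'" "j \<in> N'" "i \<noteq> j" for i j
  proof -
    have A: "t i \<in> A" "t j \<in> A" using t(2) ij assms(2) by auto
    have "t i \<noteq> t j" using t(3) ij by (auto dest: inj_onD)
    then have "strict_pref (R i) (t i) (t j)" "strict_pref (R j) (t j) (t i)"
      using top A ij by auto
    then have "0 < canonical A (R i) (t i) (t j)" "0 < canonical A (R j) (t j) (t i)"
      using canonical_pos[OF assms(1) rep str] A ij by auto
    then show ?thesis
      using canonical_antisym[OF assms(1) rep[OF ij(1)] str[OF ij(1)] A] by simp
  qed
  have "g i = t i" if "g ` N' \<subseteq> A" "\<forall>i\<in>N'. weak_pref (R i) (g i) (t i)" "i \<in> N'" for g i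
    using top[of i "g i"] that unfolding strict_pref_def by blast
  moreover have "strict_pref (R i) (t i) a" if "i \<in> N'" "a \<in> A - A'" for i a
    using top t(2) that by blast
  ultimately have "cell_assignment A R N' A' t"
    unfolding cell_assignment_def using bij swap by blast
  then show ?thesis by blast
qed

text \<open>With a common ranking of \<open>A'\<close>, placed above all other items, handing
  \<open>c p\<close> to \<open>\<pi> p\<close> is the outcome of a serial dictatorship in the order
  \<open>\<pi>\<close>, hence rigid. The homeo-monotonicity inequality is the swap clause up to
  sign.\<close>

lemma homeo_monotonic_cell_assignment:
  assumes "finite A" "A' \<subseteq> A" "homeo_monotonic A R N' A'"
    and rep: "\<And>i. i \<in> N' \<Longrightarrow> representable A (R i)"
    and str: "\<And>i. i \<in> N' \<Longrightarrow> strict_intensity A (R i)"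
  shows "\<exists>f. cell_assignment A R N' A' f"
proof -
  define r where "r = card A'"
  obtain c \<pi> where mon: "monotonic_with A R N' A' c \<pi>"
    and homeo: "\<And>p q. \<lbrakk>p \<in> {1..r}; q \<in> {1..r}; p < q\<rbrakk> \<Longrightarrow>
       canonical A (R (\<pi> q)) (c p) (c q) \<le> canonical A (R (\<pi> p)) (c p) (c q)"
    using assms(3) unfolding homeo_monotonic_def r_def by blast
  have c: "bij_betw c {1..r} A'" and \<pi>: "bij_betw \<pi> {1..r} N'"
    and top: "top_preference_coincident A R N' A'"
    and pref: "\<And>i p q. \<lbrakk>i \<in> N'; p \<in> {1..r}; q \<in> {1..r}; p < q\<rbrakk> \<Longrightarrow> strict_pref (R i) (c p) (c q)"
    using mon unfolding monotonic_with_def r_def Let_def by blast+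
  define f where "f = c \<circ> the_inv_into {1..r} \<pi>"
  have f: "f (\<pi> p) = c p" if "p \<in> {1..r}" for p
    using that \<pi> by (simp add: f_def the_inv_into_f_f bij_betw_def)
  have bij: "bij_betw f N' A'"
    unfolding f_def using bij_betw_the_inv_into[OF \<pi>] c by (rule bij_betw_trans)
  have N': "\<exists>p\<in>{1..r}. i = \<pi> p" if "i \<in> N'" for i
    using that \<pi> by (auto simp: bij_betw_def)
  have \<pi>N: "\<pi> p \<in> N'" and cA: "c p \<in> A'" if "p \<in> {1..r}" for p
    using that \<pi> c by (auto simp: bij_betw_def)
  have outside: "strict_pref (R i) a' a" if "i \<in> N'" "a' \<in> A'" "a \<in> A - A'" for i a' a
    using top that assms(2) unfolding top_preference_coincident_def by blast
  have swap: "canonical A (R i) (f j) (f i) \<le> canonical A (R j) (f j) (f i)"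
    if ij: "i \<in> N'" "j \<in> N'" "i \<noteq> j" for i j
  proof -
    obtain p q where pq: "p \<in> {1..r}" "i = \<pi> p" "q \<in> {1..r}" "j = \<pi> q"
      using N' ij by metis
    have A: "c p \<in> A" "c q \<in> A" using cA pq assms(2) by auto
    have "p \<noteq> q" using pq ij by auto
    then consider "q < p" | "p < q" by linarith
    then show ?thesis
    proof cases
      case 1
      then show ?thesis using homeo[of q p] pq f by simp
    next
      case 2
      \<comment> \<open>Here \<open>i\<close> holds the better item \<open>c p\<close>, so
        antisymmetry is applied on both sides to turn the inequality for \<open>(c p, c q)\<close>
        into the one for \<open>(c q, c p)\<close>.\<close>
      then show ?thesis
        using homeo[of p q] pq f canonical_antisym[OF assms(1) rep[OF ij(1)] str[OF ij(1)] A]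
          canonical_antisym[OF assms(1) rep[OF ij(2)] str[OF ij(2)] A] by simp
    qed
  qed
  have pareto: "\<forall>i\<in>N'. g i = f i"
    if g: "inj_on g N'" "g ` N' \<subseteq> A" "\<forall>i\<in>N'. weak_pref (R i) (g i) (f i)" for g
  proof -
    \<comment> \<open>Strong induction down the common ranking: the items better than
      \<open>c p\<close> are already taken under \<open>g\<close> by earlier agents, while a worse
      item or one outside \<open>A'\<close> would violate the weak preference for
      \<open>g\<close>.\<close>
    have "g (\<pi> p) = c p" if "p \<in> {1..r}" for p
      using that
    proof (induction p rule: less_induct)
      case (less p)
      have w: "weak_pref (R (\<pi> p)) (g (\<pi> p)) (c p)"
        using g(3) \<pi>N less.prems f by metis
      have "g (\<pi> p) \<in> A'"
        using outside[OF \<pi>N[OF less.prems] cA[OF less.prems], of "g (\<pi> p)"] w g(2) \<pi>N[OF less.prems]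
        unfolding strict_pref_def by blast
      then obtain q where q: "q \<in> {1..r}" "g (\<pi> p) = c q"
        using c by (auto simp: bij_betw_def)
      have "\<not> p < q"
        using pref[OF \<pi>N[OF less.prems] less.prems q(1)] w q(2) unfolding strict_pref_def by auto
      moreover have "\<not> q < p"
      proof
        assume "q < p"
        then have "g (\<pi> q) = g (\<pi> p)" using less.IH q by simp
        then have "\<pi> q = \<pi> p" using g(1) \<pi>N q(1) less.prems by (auto dest: inj_onD)
        then have "q = p" using \<pi> q(1) less.prems by (auto simp: bij_betw_def dest: inj_onD)
        then show False using \<open>q < p\<close> by simp
      qed
      ultimately show ?case using q by simp
    qed
    then show ?thesis using N' f by metis
  qed
  have "strict_pref (R i) (f i) a" if "i \<in> N'" "a \<in> A - A'" for i a
    using outside that bij by (auto dest: bij_betwE)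
  then have "cell_assignment A R N' A' f"
    unfolding cell_assignment_def using bij swap pareto by blast
  then show ?thesis by blast
qed

section \<open>Gluing the cells\<close>

text \<open>Two arguments with the same image must lie in cells of the same index, because the
  target cells are disjoint, and \<open>f\<close> is injective on that cell.\<close>

lemma bij_betw_UNION_disjoint_family:
  assumes "disjoint_family_on As I" and "\<And>i. i \<in> I \<Longrightarrow> bij_betw f (Ns i) (As i)"
  shows "bij_betw f (\<Union>i\<in>I. Ns i) (\<Union>i\<in>I. As i)"
proof -
  have "inj_on f (\<Union>i\<in>I. Ns i)"
  proof (rule inj_onI)
    fix x y assume "x \<in> (\<Union>i\<in>I. Ns i)" "y \<in> (\<Union>i\<in>I. Ns i)" and eq: "f x = f y"
    then obtain i j where ij: "i \<in> I" "x \<in> Ns i" "j \<in> I" "y \<in> Ns j" by blast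
    then have "f x \<in> As i" "f y \<in> As j" using assms(2) by (auto dest: bij_betwE)
    then have "i = j" using assms(1) ij eq unfolding disjoint_family_on_def by (metis disjoint_iff)
    then show "x = y" using assms(2)[OF ij(1)] ij eq by (auto simp: bij_betw_def dest: inj_onD)
  qed
  moreover have "f ` (\<Union>i\<in>I. Ns i) = (\<Union>i\<in>I. As i)"
    using assms(2) by (simp add: image_UN bij_betw_def)
  ultimately show ?thesis by (simp add: bij_betw_def)
qed

text \<open>A Pareto improvement, restricted to a cell, is excluded by rigidity. Against dominance
  it suffices to refute a single strictly gaining pair, either by the swap clause or by
  signs.\<close>

lemma intensity_efficient_if_cell_assignments:
  assumes fin: "finite A" and prof: "strict_intensity_profile n A R"
    and disA: "disjoint_family_on As I"
    and N: "(\<Union>u\<in>I. Ns u) = {1..n}" and A: "(\<Union>u\<in>I. As u) = A"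
    and cell: "\<And>u. u \<in> I \<Longrightarrow> cell_assignment A R (Ns u) (As u) x"
  shows "intensity_efficient n A R x"
proof -
  have rep: "representable A (R i)" and str: "strict_intensity A (R i)" if "i \<in> {1..n}" for i
    using prof that unfolding strict_intensity_profile_def by auto
  have cell_bij: "bij_betw x (Ns u) (As u)" if "u \<in> I" for u
    using cell[OF that] by (simp add: cell_assignment_def)
  have bij: "bij_betw x {1..n} A"
    using bij_betw_UNION_disjoint_family[OF disA cell_bij] by (simp add: N A)
  have "\<not> strict_pref (R i) (y i) (x i)"
    if y: "allocation n A y" "\<forall>i\<in>{1..n}. weak_pref (R i) (y i) (x i)" and i: "i \<in> {1..n}" for y i
  proof -
    obtain u where u: "u \<in> I" "i \<in> Ns u" using N i by blast
    have sub: "Ns u \<subseteq> {1..n}" using N u by blast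
    have "inj_on y (Ns u)" "y ` Ns u \<subseteq> A" "\<forall>i\<in>Ns u. weak_pref (R i) (y i) (x i)"
      using y sub unfolding allocation_def bij_betw_def by (blast intro: inj_on_subset)+
    then have "y i = x i" using cell[OF u(1)] u(2) unfolding cell_assignment_def by blast
    then show ?thesis by (simp add: strict_pref_def)
  qed
  then have "pareto_efficient n A R x"
    using bij unfolding pareto_efficient_def allocation_def by blast
  moreover have "\<not> intensity_dominates n A R y x" for y
  proof
    assume "intensity_dominates n A R y x"
    \<comment> \<open>The strict pair of the dominance, with the items under \<open>y\<close>
      rewritten as the exchanged items under \<open>x\<close>.\<close>
    then obtain i j where ij: "i \<in> {1..n}" "j \<in> {1..n}" "i \<noteq> j"
      and gt: "canonical A (R j) (x j) (x i) < canonical A (R i) (x j) (x i)"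
      unfolding intensity_dominates_def by auto
    obtain u v where uv: "u \<in> I" "i \<in> Ns u" "v \<in> I" "j \<in> Ns v" using N ij by blast
    have xA: "x i \<in> A" "x j \<in> A" using bij ij by (auto dest: bij_betwE)
    show False
    proof (cases "u = v")
      case True
      then have "canonical A (R i) (x j) (x i) \<le> canonical A (R j) (x j) (x i)"
        using cell[OF uv(1)] uv ij(3) unfolding cell_assignment_def by blast
      then show False using gt by simp
    next
      case False
      \<comment> \<open>Each of the two agents ranks the own item above all items of other cells, so
        \<open>(x j, x i)\<close> has a negative value for \<open>i\<close> and a positive one for
        \<open>j\<close>.\<close>
      have "x i \<in> As u" "x j \<in> As v"
        using cell_bij uv by (auto dest: bij_betwE)
      then have "x j \<in> A - As u" "x i \<in> A - As v"
        using xA disA uv False unfolding disjoint_family_on_def by blast+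
      then have "strict_pref (R i) (x i) (x j)" "strict_pref (R j) (x j) (x i)"
        using cell uv unfolding cell_assignment_def by blast+
      then have "0 < canonical A (R i) (x i) (x j)" "0 < canonical A (R j) (x j) (x i)"
        using canonical_pos[OF fin rep str] ij xA by blast+
      then show False
        using gt canonical_antisym[OF fin rep[OF ij(1)] str[OF ij(1)] xA] by simp
    qed
  qed
  ultimately show ?thesis unfolding intensity_efficient_def by blast
qed

text \<open>All clauses look at the assignment on \<open>N'\<close> only; this transfers them from
  the separate maps of the cells to the glued one.\<close>

lemma cell_assignment_cong:
  assumes "\<And>i. i \<in> N' \<Longrightarrow> f i = g i"
  shows "cell_assignment A R N' A' f \<longleftrightarrow> cell_assignment A R N' A' g"
  using bij_betw_cong[of N' f g A'] assms unfolding cell_assignment_def by simp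

theorem theorem3:
  fixes n :: nat
    and A :: "'a set"
    and R :: "nat \<Rightarrow> 'a intensity_rel"
  assumes "finite A"
    and "card A = n"
    and "strict_intensity_profile n A R"
    and "homeo_monotonic_envy_free_partition n A R"
  shows "\<exists>x. intensity_efficient n A R x"
proof -
  obtain m :: nat and Ns As E where
    disN: "disjoint_family_on Ns {1..m}" and N: "(\<Union>u\<in>{1..m}. Ns u) = {1..n}"
    and disA: "disjoint_family_on As {1..m}" and A: "(\<Union>u\<in>{1..m}. As u) = A"
    and cells: "\<And>u. u \<in> {1..m} \<Longrightarrow> if u \<in> E then envy_free A R (Ns u) (As u)
                    else homeo_monotonic A R (Ns u) (As u)"
    using assms(4) unfolding homeo_monotonic_envy_free_partition_def by metis
  have "\<exists>f. cell_assignment A R (Ns u) (As u) f" if u: "u \<in> {1..m}" for u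
  proof -
    have sub: "As u \<subseteq> A" and rep: "\<And>i. i \<in> Ns u \<Longrightarrow> representable A (R i)"
      and str: "\<And>i. i \<in> Ns u \<Longrightarrow> strict_intensity A (R i)"
      using N A assms(3) u unfolding strict_intensity_profile_def by blast+
    show ?thesis
    proof (cases "u \<in> E")
      case True
      then have "envy_free A R (Ns u) (As u)" using cells[OF u] by simp
      then show ?thesis using rep str by (rule envy_free_cell_assignment[OF assms(1) sub])
    next
      case False
      then have "homeo_monotonic A R (Ns u) (As u)" using cells[OF u] by simp
      then show ?thesis using rep str by (rule homeo_monotonic_cell_assignment[OF assms(1) sub])
    qed
  qed
  then obtain F where F: "\<And>u. u \<in> {1..m} \<Longrightarrow> cell_assignment A R (Ns u) (As u) (F u)"
    by metis
  \<comment> \<open>Each agent follows the map of the own cell; disjointness of the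
    \<open>Ns u\<close> makes the index unique.\<close>
  define x where "x i = F (THE u. u \<in> {1..m} \<and> i \<in> Ns u) i" for i
  have x_eq: "x i = F u i" if "u \<in> {1..m}" "i \<in> Ns u" for u i
  proof -
    have "(THE u. u \<in> {1..m} \<and> i \<in> Ns u) = u"
      using that disN unfolding disjoint_family_on_def by (intro the_equality) blast+
    then show ?thesis by (simp add: x_def)
  qed
  have "cell_assignment A R (Ns u) (As u) x" if "u \<in> {1..m}" for u
    using F[OF that] cell_assignment_cong[of "Ns u" x "F u", OF x_eq[OF that]] by simp
  then have "intensity_efficient n A R x"
    by (rule intensity_efficient_if_cell_assignments[OF assms(1,3) disA N A])
  then show ?thesis by blast
qed

end
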